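(* For any $k\ge0$, the sequence $N\mapsto A(N+k,N)$ is eventually polynomial. Namely, there exists a polynomial $P_k(n)\in\mathbb Q[n]$, of degree $\deg P_k=k$, such that $A(N+k,N)=P_k(N)$ for any $N\ge2$. Moreover, $P_k(n)$ admits the explicit binomial form $$P_k(n)=\sum_{j=0}^kA(k+2,2+j)\binom{n-2}{j}.$$
   Context: For $m\ge2$, $p_1(m)$ is the smallest prime divisor of $m$. For $2\le N\le n$, $A(n,N)$ (a Cyrillic "el" in the paper) is the number of compositions $(\lambda_1,\dots,\lambda_N)\in\mathbb Z_{>0}^N$ with $\lambda_1+\dots+\lambda_N=n$ and $\min\{\lambda_1,\lambda_2\}<p_1(\lambda_1+\lambda_2)$; it is the number of partial flag varieties $F_{\boldsymbol\lambda}$ of $N$-step flags in $\mathbb C^n$ whose first semiclassical spectrum is not exceeding (one gets the same number using $(\lambda_i,\lambda_{i+1})$ for any fixed $i\le N-1$). Here $\binom{n-2}{j}$ is the polynomial $\frac{(n-2)(n-3)\cdots(n-1-j)}{j!}$ in $n$. *)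

theory Defs
  imports "HOL-Computational_Algebra.Polynomial" "HOL-Computational_Algebra.Primes"
begin

definition smallest_prime_divisor :: "nat \<Rightarrow> nat"  (\<open>p\<^sub>1\<close>) where
  "p\<^sub>1 m = (LEAST p. prime p \<and> p dvd m)"

definition compositions :: "nat \<Rightarrow> nat \<Rightarrow> nat list set" where
  "compositions n N = {ls. length ls = N \<and> (\<forall>x\<in>set ls. 0 < x) \<and> sum_list ls = n}"

text \<open>Only meaningful for \<open>2 \<le> N\<close>. List positions are counted from 0, so \<open>ls ! 0\<close> and \<open>ls ! 1\<close>
  are the parts $\lambda_1$ and $\lambda_2$.\<close>

definition A :: "nat \<Rightarrow> nat \<Rightarrow> nat" where
  "A n N = card {ls \<in> compositions n N. min (ls ! 0) (ls ! 1) < p\<^sub>1 (ls ! 0 + ls ! 1)}"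

text \<open>The polynomial $\binom{n-2}{j} = (n-2)(n-3)\cdots(n-1-j)/j!$ in the indeterminate $n$;
  its \<open>i\<close>-th factor (from \<open>i = 0\<close>) is $n - (2+i)$.\<close>

definition binomial_poly :: "nat \<Rightarrow> rat poly" where
  "binomial_poly j = smult (1 / fact j) (\<Prod>i<j. [:- of_nat (2 + i), 1:])"

lemma poly_binomial_poly: "poly (binomial_poly j) x = (x - 2) gchoose j"
  by (simp add: binomial_poly_def gbinomial_prod_rev poly_prod atLeast0LessThan algebra_simps)

end

theory Submission
  imports Defs
begin

text \<open>
  The condition counted by \<^term>\<open>A n N\<close> looks at the first two parts only. If \<open>N \<ge> 2\<close>, the last of
  \<open>N + 1\<close> parts is therefore unconstrained: it either equals 1 and can be dropped, or exceeds 1 and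
  can be lowered by 1. Both moves are reversible, which gives the Pascal recurrence \<open>A_Pascal\<close>:
  \<open>A (n+1) (N+1) = A n N + A n (N+1)\<close>.

  Applying it \<open>M\<close> times (\<open>Pascal_array_iterate\<close>) treats the last \<open>M\<close> of \<open>M + 2\<close> parts at once: choose
  which \<open>j\<close> of them exceed 1, drop the others, and lower the chosen ones by 1. A composition of
  \<open>M + 2 + k\<close> thereby becomes one of \<open>k + 2\<close> into \<open>2 + j\<close> parts, so \<open>A (M+2+k) (M+2)\<close> is the sum of
  \<open>(M choose j) * A (k+2) (2+j)\<close> over all \<open>j\<close>. Since \<open>k + 2\<close> has no composition into more than
  \<open>k + 2\<close> parts, only \<open>j \<le> k\<close> contribute (\<open>A_eq_sum_choose\<close>). The range of summation and the
  coefficients no longer depend on \<open>M = N - 2\<close>, so the sum is a polynomial in \<open>N\<close>, valid for every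
  \<open>N \<ge> 2\<close>. Its degree is exactly \<open>k\<close> because the \<open>j\<close>-th binomial has degree \<open>j\<close> and the
  coefficient \<open>A (k+2) (k+2)\<close> of the last one is 1: the only candidate is the composition into ones, and it qualifies because every prime
  exceeds 1.
\<close>

lemma finite_compositions: "finite (compositions n N)"
proof (rule finite_subset)
  show "compositions n N \<subseteq> {ls. set ls \<subseteq> {..n} \<and> length ls = N}"
    by (auto simp: compositions_def member_le_sum_list)
  show "finite {ls. set ls \<subseteq> {..n} \<and> length ls = N}"
    by (intro finite_lists_length_eq) simp
qed

lemma snoc_in_compositions_iff:
  "xs @ [x] \<in> compositions n (Suc N) \<longleftrightarrow> 0 < x \<and> x \<le> n \<and> xs \<in> compositions (n - x) N"
  by (auto simp: compositions_def)

text \<open>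
  The hypothesis \<open>2 \<le> N\<close> keeps the last of \<open>N + 1\<close> parts out of the first two, so that dropping it or
  changing it preserves the condition on them. The compositions with last part 1 and those with last
  part above 1 are the images of the injections \<open>add_unit\<close> and \<open>raise_last\<close>.
\<close>

lemma A_Pascal:
  assumes "2 \<le> N"
  shows "A (Suc n) (Suc N) = A n N + A n (Suc N)"
proof -
  define ok :: "nat list \<Rightarrow> bool"
    where "ok ls \<longleftrightarrow> min (ls ! 0) (ls ! 1) < p\<^sub>1 (ls ! 0 + ls ! 1)" for ls
  define S where "S m M = {ls \<in> compositions m M. ok ls}" for m M
  have A_eq: "A m M = card (S m M)" for m M
    by (simp add: A_def S_def ok_def)
  have fin: "finite (S m M)" for m M
    by (simp add: S_def finite_compositions)
  have snoc_in_S: "xs @ [x] \<in> S m (Suc N) \<longleftrightarrow> 0 < x \<and> x \<le> m \<and> xs \<in> S (m - x) N" for xs x m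
    using assms by (auto simp: S_def snoc_in_compositions_iff ok_def compositions_def nth_append)
  have snocE: "\<exists>xs x. ls = xs @ [x]" if "ls \<in> S m (Suc N)" for ls m
    using that by (cases ls rule: rev_cases) (auto simp: S_def compositions_def)
  define add_unit :: "nat list \<Rightarrow> nat list" where "add_unit xs = xs @ [1]" for xs
  define raise_last :: "nat list \<Rightarrow> nat list" where "raise_last ls = butlast ls @ [Suc (last ls)]" for ls
  have split: "S (Suc n) (Suc N) = add_unit ` S n N \<union> raise_last ` S n (Suc N)"
  proof (intro set_eqI iffI)
    fix ls assume ls: "ls \<in> S (Suc n) (Suc N)"
    then obtain xs x where [simp]: "ls = xs @ [x]" using snocE by blast
    from ls have x: "0 < x" "x \<le> Suc n" "xs \<in> S (Suc n - x) N" by (auto simp: snoc_in_S)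
    show "ls \<in> add_unit ` S n N \<union> raise_last ` S n (Suc N)"
    proof (cases "x = 1")
      case True
      with x show ?thesis by (auto simp: add_unit_def)
    next
      case False
      with x have "xs @ [x - 1] \<in> S n (Suc N)"
        by (auto simp: snoc_in_S)
      moreover have "ls = raise_last (xs @ [x - 1])"
        using x by (simp add: raise_last_def)
      ultimately show ?thesis by blast
    qed
  next
    fix ls assume "ls \<in> add_unit ` S n N \<union> raise_last ` S n (Suc N)"
    then show "ls \<in> S (Suc n) (Suc N)"
    proof
      assume "ls \<in> add_unit ` S n N"
      then show ?thesis by (auto simp: add_unit_def snoc_in_S)
    next
      assume "ls \<in> raise_last ` S n (Suc N)"
      then obtain ls' where ls': "ls = raise_last ls'" "ls' \<in> S n (Suc N)" by blast
      then obtain xs x where "ls' = xs @ [x]" using snocE by blast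
      with ls' show ?thesis by (auto simp: raise_last_def snoc_in_S)
    qed
  qed
  have last_pos: "0 < last ls" if ls: "ls \<in> S n (Suc N)" for ls
  proof -
    obtain xs x where "ls = xs @ [x]" using snocE[OF ls] by blast
    with ls show ?thesis by (simp add: snoc_in_S)
  qed
  have disj: "add_unit ` S n N \<inter> raise_last ` S n (Suc N) = {}"
    using last_pos by (fastforce simp: add_unit_def raise_last_def)
  have inj_add: "inj_on add_unit (S n N)"
    by (auto simp: inj_on_def add_unit_def)
  have inj_raise: "inj_on raise_last (S n (Suc N))"
  proof (rule inj_onI)
    fix ls ls' assume S: "ls \<in> S n (Suc N)" "ls' \<in> S n (Suc N)" and eq: "raise_last ls = raise_last ls'"
    obtain xs x where "ls = xs @ [x]" using snocE[OF S(1)] by blast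
    moreover obtain xs' x' where "ls' = xs' @ [x']" using snocE[OF S(2)] by blast
    ultimately show "ls = ls'" using eq by (simp add: raise_last_def)
  qed
  show ?thesis
    unfolding A_eq split
    by (simp add: card_Un_disjoint fin disj card_image inj_add inj_raise)
qed

lemma A_eq_0:
  assumes "n < N"
  shows "A n N = 0"
proof -
  have "length ls \<le> sum_list ls" if "\<forall>x\<in>set ls. 0 < x" for ls :: "nat list"
    using that by (induction ls) auto
  then have "compositions n N = {}"
    using assms by (fastforce simp: compositions_def)
  then show ?thesis by (simp add: A_def)
qed

lemma A_2_2: "A 2 2 = 1"
proof -
  have "prime (p\<^sub>1 2)"
    unfolding smallest_prime_divisor_def
    using LeastI[of "\<lambda>p. prime p \<and> p dvd 2" "2::nat"] by simp
  then have gt: "Suc 0 < p\<^sub>1 (Suc (Suc 0))"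
    using prime_gt_1_nat[of "p\<^sub>1 2"] by (simp add: numeral_2_eq_2)
  have only_comp: "compositions 2 2 = {[1, 1]}"
    by (auto simp: compositions_def length_Suc_conv numeral_2_eq_2)
  have "{ls \<in> compositions 2 2. min (ls ! 0) (ls ! 1) < p\<^sub>1 (ls ! 0 + ls ! 1)} = {[1, 1]}"
    unfolding only_comp using gt by auto
  then show ?thesis by (simp add: A_def)
qed

text \<open>
  On the diagonal the second term of the Pascal recurrence vanishes, so the value is constant there.
\<close>

lemma A_diag: "A (k + 2) (k + 2) = 1"
proof (induction k)
  case 0
  show ?case using A_2_2 by (simp add: numeral_2_eq_2)
next
  case (Suc k)
  then show ?case using A_Pascal[of "k + 2" "k + 2"] by (simp add: A_eq_0)
qed

text \<open>
  Each use of the recurrence replaces an entry by the sum of two entries of the previous row,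
  one in the same column and one a column to the left. The binomial coefficient counts the
  ways of staying in the column \<open>j\<close> times in \<open>M\<close> such steps, which start at column \<open>M + i\<close> and end at
  column \<open>i + j\<close>. Keeping the offset \<open>i\<close> arbitrary is what makes the induction on \<open>M\<close> close.
\<close>

lemma Pascal_array_iterate:
  fixes a :: "nat \<Rightarrow> nat \<Rightarrow> 'a::comm_semiring_1"
  assumes Pascal: "\<And>n i. a (Suc n) (Suc i) = a n i + a n (Suc i)"
  shows "a (M + k) (M + i) = (\<Sum>j\<le>M. of_nat (M choose j) * a k (i + j))"
proof (induction M arbitrary: i)
  case 0
  show ?case by simp
next
  case (Suc M)
  let ?S = "\<lambda>i. \<Sum>j\<le>M. of_nat (M choose j) * a k (i + j)"
  have "?S i = a k i + (\<Sum>j\<le>M. of_nat (M choose Suc j) * a k (Suc (i + j)))"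
  proof -
    have "?S i = (\<Sum>j\<le>Suc M. of_nat (M choose j) * a k (i + j))"
      by (simp add: binomial_eq_0)
    also have "\<dots> = a k i + (\<Sum>j\<le>M. of_nat (M choose Suc j) * a k (Suc (i + j)))"
      by (subst sum.atMost_Suc_shift) simp
    finally show ?thesis .
  qed
  moreover have "(\<Sum>j\<le>Suc M. of_nat (Suc M choose j) * a k (i + j))
      = a k i + (\<Sum>j\<le>M. of_nat (M choose Suc j) * a k (Suc (i + j))) + ?S (Suc i)"
    by (subst sum.atMost_Suc_shift) (simp add: distrib_right sum.distrib add_ac)
  ultimately show ?case
    using Suc.IH[of i] Suc.IH[of "Suc i"] by (simp add: Pascal)
qed

text \<open>
  The iterated recurrence sums up to \<open>j = M\<close>. The bound can be changed to \<open>k\<close>, which no longer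
  depends on \<open>M\<close>: for \<open>j > M\<close> the binomial coefficient is 0, and for \<open>j > k\<close> the other factor is.
\<close>

lemma A_eq_sum_choose:
  "A (M + 2 + k) (M + 2) = (\<Sum>j\<le>k. A (k + 2) (2 + j) * (M choose j))"
proof -
  have "A (M + 2 + k) (M + 2) = (\<Sum>j\<le>M. (M choose j) * A (k + 2) (j + 2))"
    using Pascal_array_iterate[of "\<lambda>n i. A (n + 2) (i + 2)" M k 0] A_Pascal
    by (simp add: add_ac)
  also have "\<dots> = (\<Sum>j\<le>max M k. (M choose j) * A (k + 2) (j + 2))"
    by (rule sum.mono_neutral_left) auto
  also have "\<dots> = (\<Sum>j\<le>k. (M choose j) * A (k + 2) (j + 2))"
    by (rule sum.mono_neutral_right) (auto simp: A_eq_0)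
  finally show ?thesis by (simp add: mult.commute add.commute)
qed

lemma degree_binomial_poly: "degree (binomial_poly j) = j"
  by (simp add: binomial_poly_def degree_prod_eq_sum_degree)

lemma poly_binomial_poly_of_nat:
  "poly (binomial_poly j) (of_nat (M + 2)) = of_nat (M choose j)"
  by (simp add: poly_binomial_poly binomial_gbinomial)

lemma degree_sum_binomial_poly:
  assumes "c k \<noteq> 0"
  shows "degree (\<Sum>j=0..k. smult (c j) (binomial_poly j)) = k"
proof (rule antisym)
  show "degree (\<Sum>j=0..k. smult (c j) (binomial_poly j)) \<le> k"
    by (intro degree_sum_le) (auto simp: degree_binomial_poly)
  have "coeff (binomial_poly j) k = 0" if "j < k" for j
    using that by (simp add: coeff_eq_0 degree_binomial_poly)
  then have "coeff (\<Sum>j=0..k. smult (c j) (binomial_poly j)) k = c k * coeff (binomial_poly k) k"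
    by (simp add: coeff_sum atLeast0AtMost lessThan_Suc_atMost [symmetric])
  also have "\<dots> \<noteq> 0"
  proof -
    have "binomial_poly k \<noteq> 0" by (simp add: binomial_poly_def)
    then have "lead_coeff (binomial_poly k) \<noteq> 0" by simp
    with assms show ?thesis by (simp add: degree_binomial_poly)
  qed
  finally show "k \<le> degree (\<Sum>j=0..k. smult (c j) (binomial_poly j))"
    by (rule le_degree)
qed

theorem theorem4p25:
  fixes k :: nat
  shows "\<exists>P :: rat poly.
           degree P = k \<and>
           (\<forall>N\<ge>2. of_nat (A (N + k) N) = poly P (of_nat N)) \<and>
           P = (\<Sum>j=0..k. smult (of_nat (A (k + 2) (2 + j))) (binomial_poly j))"
proof -
  define P :: "rat poly"
    where "P = (\<Sum>j=0..k. smult (of_nat (A (k + 2) (2 + j))) (binomial_poly j))"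
  have "degree P = k"
    unfolding P_def using A_diag[of k]
    by (intro degree_sum_binomial_poly) (simp add: add.commute)
  moreover have "of_nat (A (N + k) N) = poly P (of_nat N)" if "2 \<le> N" for N
  proof -
    define M where "M = N - 2"
    have N: "N = M + 2" using that by (simp add: M_def)
    have "of_nat (A (N + k) N) = (\<Sum>j\<le>k. of_nat (A (k + 2) (2 + j)) * of_nat (M choose j) :: rat)"
      unfolding N A_eq_sum_choose by (simp only: of_nat_sum of_nat_mult)
    also have "\<dots> = poly P (of_nat N)"
      unfolding P_def N poly_sum poly_smult poly_binomial_poly_of_nat atLeast0AtMost ..
    finally show ?thesis .
  qed
  ultimately show ?thesis
    using P_def by blast
qed

end
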